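(* Let $a<b$ and $c<d$ be real numbers, let $\Delta=[a,b]\times[c,d]\subset\mathbb{R}^2$, and let $f:\Delta\to\mathbb{R}$ be a partial differentiable mapping on $\Delta$ whose mixed second partial derivative $\frac{\partial^2 f}{\partial t\partial s}$ exists on $\Delta$. If $\frac{\partial^2 f}{\partial t\partial s}\in L(\Delta)$, then $$ \begin{aligned} &\frac{f\left(a,\frac{c+d}{2}\right)+f\left(b,\frac{c+d}{2}\right)+4f\left(\frac{a+b}{2},\frac{c+d}{2}\right)+f\left(\frac{a+b}{2},c\right)+f\left(\frac{a+b}{2},d\right)}{9}\\ &+\frac{f(a,c)+f(b,c)+f(a,d)+f(b,d)}{36}\\ &-\frac{1}{6(b-a)}\int_a^b\left[f(x,c)+4f\left(x,\frac{c+d}{2}\right)+f(x,d)\right]dx\\ &-\frac{1}{6(d-c)}\int_c^d\left[f(a,y)+4f\left(\frac{a+b}{2},y\right)+f(b,y)\right]dy\\ &+\frac{1}{(b-a)(d-c)}\int_a^b\int_c^d f(x,y)\,dy\,dx\\ ={}&(b-a)(d-c)\int_0^1\int_0^1 p(t)\,q(s)\,\frac{\partial^2 f}{\partial t\partial s}\bigl(ta+(1-t)b,\;sc+(1-s)d\bigr)\,dt\,ds, \end{aligned} $$ where $$ p(t)=\begin{cases}t-\frac16,& t\in\left[0,\frac12\right],\\[2pt] t-\frac56,& t\in\left(\frac12,1\right],\end{cases} \qquad q(s)=\begin{cases}s-\frac16,& s\in\left[0,\frac12\right],\\[2pt] s-\frac56,& s\in\left(\frac12,1\right].\end{cases} 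$$
   Context: The notation $\frac{\partial^2 f}{\partial t\partial s}$ denotes the mixed second partial derivative of $f$, with $s$ standing for the second variable and $t$ for the first: it is the partial derivative with respect to the first variable of the partial derivative $\frac{\partial f}{\partial s}$ of $f$ with respect to the second variable; in the integral it is evaluated at the point $(ta+(1-t)b,\,sc+(1-s)d)$. "Partial differentiable" means that the first-order partial derivatives of $f$ exist on $\Delta$ (one-sided at the boundary). $L(\Delta)$ is the space of Lebesgue integrable functions on $\Delta$. *)

theory Defs
  imports "HOL-Analysis.Analysis"
begin

text \<open>Both weights p and q of the identity are this one function; they are integrated over [0,1]
  only, so the values outside that interval are irrelevant.\<close>

definition simpson_kernel :: "real \<Rightarrow> real" where
  "simpson_kernel t = (if t \<le> 1/2 then t - 1/6 else t - 5/6)"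

end

theory Submission
  imports Defs
begin

text \<open>For one variable, let the Simpson defect of a function be its Simpson mean
  $(\phi(a) + 4\phi((a+b)/2) + \phi(b))/6$ minus its integral mean over $[a,b]$. Grouping terms shows
  that the left-hand side of the identity is the two-dimensional defect of $f$: the defect in $y$
  of $f(x,\cdot)$, followed by the defect in $x$ (\<open>simpson_defect_iterated\<close>).

  The defect is linear and kills constants, so it kills every summand of $f$ that depends on one
  variable alone. What remains of $f$ is the double increment
  $f(x,y) - f(a,y) - f(x,c) + f(a,c)$, which equals the integral of the mixed derivative over
  $[a,x]\times[c,y]$ (\<open>rectangle_increment_eq_integral_of_mixed_derivative\<close>). This makes $f$,
  up to such summands, a superposition of products of unit steps $1_{u<x}\,1_{v<y}$ with
  weights given by the mixed derivative at $(u,v)$. The defect of one unit step that jumps at $u$ is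
  $-p((b-u)/(b-a))$, and by Fubini's theorem the defect may be taken under the integral
  (\<open>simpson_defect_superposition_of_steps\<close>). Doing this in both variables gives the integral of
  $p\,q$ times the mixed derivative; the two signs cancel, and the affine substitution
  $u = ta+(1-t)b$, $v = sc+(1-s)d$ yields the right-hand side
  (\<open>kernel_integral_eq_representative\<close>).

  The delicate point is that $\partial f/\partial s$ is only a derivative and may fail to be
  Lebesgue integrable along lines. Only differences
  $\partial f/\partial s(x,\cdot) - \partial f/\partial s(a,\cdot)$ are therefore integrated; for
  almost every second coordinate they are given by an integral of the mixed derivative, so they
  are integrable by Fubini's theorem. The fundamental theorem of calculus is used for the
  gauge integral, which integrates every derivative, and is then compared with the Lebesgue
  integral. Fubini's theorem is applied to a Borel function that agrees with the mixed
  derivative almost everywhere.\<close>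

section \<open>Integrals over the completed Lebesgue measure\<close>

text \<open>Iterated integrals over completed measures are evaluated by passing to Borel functions, for
  which the product structure of \<open>lborel\<close> is available. Completeness makes $f$ measurable as soon
  as it agrees with a Borel function almost everywhere, and this is all that is known about the
  sections that occur as inner integrands.\<close>

lemma lebesgue_integral_eq_lborel_representative:
  fixes f g :: "'a::euclidean_space \<Rightarrow> real"
  assumes "g \<in> borel_measurable lborel" and "AE x in lborel. f x = g x"
  shows "integral\<^sup>L lebesgue f = integral\<^sup>L lborel g"
proof -
  have ae: "AE x in lebesgue. g x = f x"
    using assms(2) by (intro AE_completion) auto
  have g: "g \<in> borel_measurable lebesgue"
    using assms(1) by (rule measurable_completion)
  then have "f \<in> borel_measurable lebesgue"
    using ae by (rule borel_measurable_AE)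
  then have "integral\<^sup>L lebesgue f = integral\<^sup>L lebesgue g"
    using g ae by (intro integral_cong_AE) auto
  with assms(1) show ?thesis by (simp add: integral_completion)
qed

lemma lebesgue_integrable_real_affine:
  fixes f :: "real \<Rightarrow> real"
  assumes "integrable lebesgue f" "c \<noteq> 0"
  shows "integrable lebesgue (\<lambda>x. f (t + c * x))"
proof -
  have T: "(\<lambda>x. t + c * x) \<in> lebesgue \<rightarrow>\<^sub>M lebesgue"
    using lebesgue_affine_measurable[of "\<lambda>_. c" t] assms(2) by simp
  have "f \<in> borel_measurable lebesgue"
    using assms(1) by auto
  have "(\<lambda>x. f (t + c * x)) \<in> borel_measurable lebesgue"
    using measurable_compose[OF T \<open>f \<in> borel_measurable lebesgue\<close>] .
  then show ?thesis
    using assms nn_integral_real_affine_lebesgue[of "\<lambda>x. ennreal (norm (f x))" c t]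
    by (auto simp: integrable_iff_bounded ennreal_mult_less_top)
qed

text \<open>The identity extends to all functions because an affine bijection preserves
  non-integrability, in which case both integrals are $0$ by convention.\<close>

lemma lebesgue_integral_real_affine:
  fixes f :: "real \<Rightarrow> real"
  assumes "c \<noteq> 0"
  shows "integral\<^sup>L lebesgue f = \<bar>c\<bar> * (LINT x|lebesgue. f (t + c * x))"
proof (cases "integrable lebesgue f")
  case True
  have T: "(\<lambda>x. t + c * x) \<in> lebesgue \<rightarrow>\<^sub>M lebesgue"
    using lebesgue_affine_measurable[of "\<lambda>_. c" t] assms by simp
  have "integral\<^sup>L lebesgue f
      = integral\<^sup>L (density (distr lebesgue lebesgue (\<lambda>x. t + c * x)) (\<lambda>_. ennreal \<bar>c\<bar>)) f"
    using lebesgue_real_affine[OF assms, of t] by simp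
  also have "\<dots> = \<bar>c\<bar> * (LINT x|lebesgue. f (t + c * x))"
    using True T by (subst integral_density) (auto simp: integral_distr)
  finally show ?thesis .
next
  case False
  then have "\<not> integrable lebesgue (\<lambda>x. f (t + c * x))"
    using lebesgue_integrable_real_affine[of "\<lambda>x. f (t + c * x)" "1/c" "-t/c"] assms
    by (auto simp: field_simps)
  with False show ?thesis by (simp add: not_integrable_integral_eq)
qed

lemma lebesgue_integral_unit_parametrization:
  fixes \<phi> :: "real \<Rightarrow> real"
  assumes "a < b"
  shows "(LINT t:{0..1}|lebesgue. \<phi> (t * a + (1 - t) * b)) = (LINT u:{a..b}|lebesgue. \<phi> u) / (b - a)"
proof -
  have eq: "b + (a - b) * t = t * a + (1 - t) * b" for t
    by (simp add: algebra_simps)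
  have mem: "t * a + (1 - t) * b \<in> {a..b} \<longleftrightarrow> t \<in> {0..1}" for t
  proof -
    have "t * a + (1 - t) * b - a = (1 - t) * (b - a)" "b - (t * a + (1 - t) * b) = t * (b - a)"
      by (simp_all add: algebra_simps)
    then have "(a \<le> t * a + (1 - t) * b \<longleftrightarrow> 0 \<le> (1 - t) * (b - a))"
      "(t * a + (1 - t) * b \<le> b \<longleftrightarrow> 0 \<le> t * (b - a))"
      by linarith+
    then show ?thesis using assms by (auto simp: zero_le_mult_iff)
  qed
  have "(LINT u:{a..b}|lebesgue. \<phi> u)
      = \<bar>a - b\<bar> * (LINT t|lebesgue. indicator {a..b} (b + (a - b) * t) *\<^sub>R \<phi> (b + (a - b) * t))"
    unfolding set_lebesgue_integral_def
    using assms by (intro lebesgue_integral_real_affine) auto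
  also have "\<dots> = (b - a) * (LINT t:{0..1}|lebesgue. \<phi> (t * a + (1 - t) * b))"
    unfolding set_lebesgue_integral_def eq using assms mem by (simp add: indicator_def)
  finally show ?thesis using assms by simp
qed

section \<open>The Simpson defect and its kernel\<close>

definition simpson_defect :: "real \<Rightarrow> real \<Rightarrow> (real \<Rightarrow> real) \<Rightarrow> real" where
  "simpson_defect a b \<phi> =
    (\<phi> a + 4 * \<phi> ((a + b) / 2) + \<phi> b) / 6 - (LINT x:{a..b}|lebesgue. \<phi> x) / (b - a)"

lemma simpson_defect_cong:
  assumes "a < b" "\<And>x. x \<in> {a..b} \<Longrightarrow> \<phi> x = \<psi> x"
  shows "simpson_defect a b \<phi> = simpson_defect a b \<psi>"
proof -
  have "(LINT x:{a..b}|lebesgue. \<phi> x) = (LINT x:{a..b}|lebesgue. \<psi> x)"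
    using assms by (intro set_lebesgue_integral_cong) auto
  with assms show ?thesis by (simp add: simpson_defect_def)
qed

lemma simpson_defect_add:
  assumes "set_integrable lebesgue {a..b} \<phi>" "set_integrable lebesgue {a..b} \<psi>"
  shows "simpson_defect a b (\<lambda>x. \<phi> x + \<psi> x) = simpson_defect a b \<phi> + simpson_defect a b \<psi>"
  using assms by (simp add: simpson_defect_def add_divide_distrib algebra_simps)

lemma set_integrable_const_interval: "set_integrable lebesgue {a..b} (\<lambda>_. k::real)"
  for a b :: real
  by (intro absolutely_integrable_continuous_real continuous_intros)

lemma simpson_defect_const: "a < b \<Longrightarrow> simpson_defect a b (\<lambda>_. k) = 0"
  by (simp add: simpson_defect_def set_integral_const)

lemma borel_measurable_simpson_kernel [measurable]: "simpson_kernel \<in> borel_measurable borel"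
  unfolding simpson_kernel_def[abs_def] by measurable

lemma abs_simpson_kernel_le_1: "0 \<le> t \<Longrightarrow> t \<le> 1 \<Longrightarrow> \<bar>simpson_kernel t\<bar> \<le> 1"
  by (auto simp: simpson_kernel_def)

text \<open>The unit step $1_{k<x}$ has Simpson mean $5/6$ or $1/6$, according to whether the jump $k$ lies
  left of the midpoint, and integral mean $(b-k)/(b-a)$; the difference is minus the kernel at
  $(b-k)/(b-a)$. Since all steps are bounded by $1$ on a bounded interval, Fubini's theorem lets the
  defect act inside the integral. With the strict step $1_{k<x}$, the two formulas agree also
  for a jump at the midpoint, where the kernel takes its left value $1/3$; a jump at $b$ would break
  the agreement, which is why the jumps are confined to the open interval. The measure space is
  arbitrary so that the lemma can be applied in each coordinate of the plane in turn.\<close>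

lemma simpson_defect_superposition_of_steps:
  fixes k G :: "'a \<Rightarrow> real"
  assumes "sigma_finite_measure M" and "a < b"
    and G: "integrable M G" and k [measurable]: "k \<in> borel_measurable M"
    and supp: "\<And>z. G z \<noteq> 0 \<Longrightarrow> k z \<in> {a<..<b}"
  shows "set_integrable lebesgue {a..b} (\<lambda>x. LINT z|M. indicator {k z<..} x * G z)" (is ?int)
    and "simpson_defect a b (\<lambda>x. LINT z|M. indicator {k z<..} x * G z)
      = - (LINT z|M. simpson_kernel ((b - k z) / (b - a)) * G z)" (is ?eq)
proof -
  interpret M: sigma_finite_measure M by fact
  interpret pair_sigma_finite M lborel ..
  have Gm [measurable]: "G \<in> borel_measurable M" using G by auto
  let ?F = "\<lambda>x. LINT z|M. indicator {k z<..} x * G z"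
  let ?W = "\<lambda>z x. indicator {a..b} x * (indicator {k z<..} x * G z)"
  have [measurable]: "(\<lambda>(z, x). indicator {k z<..} x :: real) \<in> borel_measurable (M \<Otimes>\<^sub>M lborel)"
    unfolding indicator_def greaterThan_iff by measurable
  have Icc: "integrable lborel (indicat_real {a..b})"
    by (rule integrable_real_indicator) (auto simp: emeasure_lborel_Icc_eq)
  \<comment> \<open>On the bounded interval the steps are dominated by \<open>|G z|\<close>, which is integrable on the product.\<close>
  have dom: "integrable (M \<Otimes>\<^sub>M lborel) (\<lambda>(z, x). indicator {a..b} x * G z)"
  proof (rule Fubini_integrable)
    show "integrable M (\<lambda>z. LINT x|lborel. norm (case (z, x) of (z, x) \<Rightarrow> indicator {a..b} x * G z))"
      using G by (simp add: abs_mult)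
    show "AE z in M. integrable lborel (\<lambda>x. case (z, x) of (z, x) \<Rightarrow> indicator {a..b} x * G z)"
      using Icc by simp
  qed measurable
  have W: "integrable (M \<Otimes>\<^sub>M lborel) (case_prod ?W)"
    by (rule Bochner_Integration.integrable_bound[OF dom])
      (auto simp: indicator_def intro!: always_eventually)
  have Fm: "(\<lambda>x. indicator {a..b} x * ?F x) \<in> borel_measurable lborel"
    by measurable
  have "integrable lborel (\<lambda>x. LINT z|M. ?W z x)"
    using integrable_snd[OF W] .
  then have Fint: "integrable lborel (\<lambda>x. indicator {a..b} x * ?F x)"
    by simp
  then show ?int
    unfolding set_integrable_def using Fm by (simp add: integrable_completion)
  have Gb: "integrable M (\<lambda>z. (b - k z) * G z)"
  proof (rule Bochner_Integration.integrable_bound)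
    show "integrable M (\<lambda>z. (b - a) * G z)" using G by simp
    show "AE z in M. norm ((b - k z) * G z) \<le> norm ((b - a) * G z)"
    proof (intro always_eventually allI)
      fix z
      show "norm ((b - k z) * G z) \<le> norm ((b - a) * G z)"
      proof (cases "G z = 0")
        case False
        then have "a < k z" "k z < b" using supp by auto
        then show ?thesis by (simp add: abs_mult mult_right_mono)
      qed simp
    qed
  qed measurable
  have indG: "integrable M (\<lambda>z. indicator {k z<..} x * G z)" for x
  proof (rule Bochner_Integration.integrable_bound[OF G])
    show "AE z in M. norm (indicator {k z<..} x * G z) \<le> norm (G z)"
      by (intro always_eventually) (auto simp: indicator_def)
    show "(\<lambda>z. indicator {k z<..} x * G z) \<in> borel_measurable M"
      unfolding indicator_def greaterThan_iff by measurable
  qed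
  have "(LINT x:{a..b}|lebesgue. ?F x) = (LINT x|lborel. indicator {a..b} x * ?F x)"
    unfolding set_lebesgue_integral_def using Fm by (simp add: integral_completion)
  also have "\<dots> = (LINT x|lborel. LINT z|M. ?W z x)"
    by simp
  also have "\<dots> = (LINT z|M. LINT x|lborel. ?W z x)"
    using Fubini_integral[OF W] .
  also have "\<dots> = (LINT z|M. (b - k z) * G z)"
  proof (rule Bochner_Integration.integral_cong[OF refl])
    fix z
    show "(LINT x|lborel. ?W z x) = (b - k z) * G z"
    proof (cases "G z = 0")
      case False
      then have "a < k z" "k z < b" using supp by auto
      then have "(\<lambda>x. ?W z x) = (\<lambda>x. indicator {k z<..b} x * G z)"
        by (auto simp: indicator_def fun_eq_iff)
      with \<open>k z < b\<close> show ?thesis by simp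
    qed simp
  qed
  finally have I: "(LINT x:{a..b}|lebesgue. ?F x) = (LINT z|M. (b - k z) * G z)" .
  have "simpson_defect a b ?F = (LINT z|M. (indicator {k z<..} a * G z
      + 4 * (indicator {k z<..} ((a + b) / 2) * G z) + indicator {k z<..} b * G z) / 6
      - (b - k z) * G z / (b - a))"
    unfolding simpson_defect_def I using indG Gb by simp
  also have "\<dots> = (LINT z|M. - (simpson_kernel ((b - k z) / (b - a)) * G z))"
  proof (rule Bochner_Integration.integral_cong[OF refl])
    fix z
    show "(indicator {k z<..} a * G z
      + 4 * (indicator {k z<..} ((a + b) / 2) * G z) + indicator {k z<..} b * G z) / 6
      - (b - k z) * G z / (b - a) = - (simpson_kernel ((b - k z) / (b - a)) * G z)"
    proof (cases "G z = 0")
      case False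
      then have z: "a < k z" "k z < b" using supp by auto
      have "(b - k z) / (b - a) \<le> 1/2 \<longleftrightarrow> \<not> k z < (a + b) / 2"
        using \<open>a < b\<close> by (auto simp: field_simps)
      with z show ?thesis
        by (auto simp: simpson_kernel_def indicator_def algebra_simps)
    qed simp
  qed
  finally show ?eq by simp
qed

section \<open>The double increment as an integral of the mixed derivative\<close>

text \<open>The edges of the rectangle have measure zero, so the representative can be required to vanish
  there; this keeps all jumps in the open intervals. The order of the two almost-everywhere
  quantifiers is the one needed for fixing the second coordinate first.\<close>

lemma borel_representative_on_open_rectangle:
  fixes g :: "real \<times> real \<Rightarrow> real"
  assumes g: "g absolutely_integrable_on ({a..b} \<times> {c..d})"
  obtains h where "integrable lborel h"
    and "\<And>z. h z \<noteq> 0 \<Longrightarrow> fst z \<in> {a<..<b} \<and> snd z \<in> {c<..<d}"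
    and "AE v in lborel. AE u in lborel. u \<in> {a<..<b} \<longrightarrow> v \<in> {c<..<d} \<longrightarrow> g (u, v) = h (u, v)"
proof -
  let ?D = "{a..b} \<times> {c..d}" and ?O = "{a<..<b} \<times> {c<..<d}"
  have O: "?O \<in> sets borel" by (intro borel_open open_Times) auto
  have int: "integrable lebesgue (\<lambda>z. indicator ?D z *\<^sub>R g z)"
    using g by (simp add: set_integrable_def)
  then obtain h0 where h0 [measurable]: "h0 \<in> borel_measurable lborel"
    and ae: "AE z in lborel. indicator ?D z *\<^sub>R g z = h0 z"
    using completion_ex_borel_measurable_real[of "\<lambda>z. indicator ?D z *\<^sub>R g z" lborel] by auto
  have "AE z in lebesgue. h0 z = indicator ?D z *\<^sub>R g z"
    using ae by (intro AE_completion) auto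
  then have "integrable lebesgue h0"
    by (intro integrable_cong_AE_imp[OF int]) (auto simp: measurable_completion h0 eq_commute)
  then have h0_int: "integrable lborel h0"
    using h0 by (simp add: integrable_completion)
  define h where "h = (\<lambda>z. indicator ?O z * h0 z)"
  have "integrable lborel h"
    unfolding h_def using integrable_mult_indicator[OF _ h0_int, of ?O] O by simp
  moreover have "fst z \<in> {a<..<b} \<and> snd z \<in> {c<..<d}" if "h z \<noteq> 0" for z
    using that by (auto simp: h_def indicator_def split: if_splits)
  moreover have "AE v in lborel. AE u in lborel. u \<in> {a<..<b} \<longrightarrow> v \<in> {c<..<d} \<longrightarrow> g (u, v) = h (u, v)"
  proof -
    obtain N where N: "N \<in> sets borel" "emeasure lborel N = 0"
      "{z. indicator ?D z *\<^sub>R g z \<noteq> h0 z} \<subseteq> N"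
      using ae by (auto elim!: AE_E)
    have "AE z in lborel \<Otimes>\<^sub>M lborel. z \<notin> N"
      unfolding lborel_prod using N by (intro AE_not_in) auto
    then have "AE u in lborel. AE v in lborel. (u, v) \<notin> N"
      by (rule lborel_pair.AE_pair)
    moreover have "(AE u in lborel. AE v in lborel. (u, v) \<notin> N)
        \<longleftrightarrow> (AE v in lborel. AE u in lborel. (u, v) \<notin> N)"
    proof (rule lborel_pair.AE_commute)
      have "{z \<in> space (lborel \<Otimes>\<^sub>M lborel). (fst z, snd z) \<notin> N} = - N"
        by (auto simp: space_pair_measure)
      then show "{z \<in> space (lborel \<Otimes>\<^sub>M lborel). (fst z, snd z) \<notin> N} \<in> sets (lborel \<Otimes>\<^sub>M lborel)"
        unfolding lborel_prod using N(1) by auto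
    qed
    ultimately have "AE v in lborel. AE u in lborel. (u, v) \<notin> N" by simp
    then show ?thesis
    proof eventually_elim
      case (elim v)
      then show ?case
      proof eventually_elim
        case (elim u)
        then have "indicator ?D (u, v) *\<^sub>R g (u, v) = h0 (u, v)" using N(3) by auto
        then show ?case by (auto simp: h_def indicator_def)
      qed
    qed
  qed
  ultimately show ?thesis using that by blast
qed

text \<open>Every derivative is gauge integrable with the expected value. If it agrees almost everywhere
  with a Lebesgue integrable function, the gauge and Lebesgue integrals coincide. The upper limit
  enters as the step $1_{u<x}$, which suffices because the integrand vanishes below $a$.\<close>

lemma increment_eq_lebesgue_integral_of_derivative:
  fixes F F' w :: "real \<Rightarrow> real"
  assumes deriv: "\<And>x. x \<in> {a..b} \<Longrightarrow> (F has_real_derivative F' x) (at x within {a..b})"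
    and w: "integrable lborel w" and supp: "\<And>x. w x \<noteq> 0 \<Longrightarrow> x \<in> {a<..<b}"
    and ae: "AE x in lborel. x \<in> {a<..<b} \<longrightarrow> F' x = w x"
    and x: "x \<in> {a..b}"
  shows "F x - F a = (LINT u|lborel. indicator {u<..} x * w u)"
proof -
  have "(F' has_integral F x - F a) {a..x}"
  proof (rule fundamental_theorem_of_calculus)
    fix u assume "u \<in> {a..x}"
    then have "(F has_real_derivative F' u) (at u within {a..x})"
      using x by (intro DERIV_subset[OF deriv]) auto
    then show "(F has_vector_derivative F' u) (at u within {a..x})"
      by (simp add: has_real_derivative_iff_has_vector_derivative)
  qed (use x in auto)
  then have "(F' has_integral F x - F a) {a<..<x}"
    by (simp add: has_integral_Icc_iff_Ioo)
  moreover have "(F' has_integral F x - F a) {a<..<x} \<longleftrightarrow> (w has_integral F x - F a) {a<..<x}"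
    using ae x by (intro has_integral_AE) auto
  ultimately have "((\<lambda>u. if u \<in> {a<..<x} then w u else 0) has_integral F x - F a) UNIV"
    by (simp only: has_integral_restrict_UNIV)
  also have "(\<lambda>u. if u \<in> {a<..<x} then w u else 0) = (\<lambda>u. indicator {u<..} x * w u)"
  proof
    fix u
    show "(if u \<in> {a<..<x} then w u else 0) = indicator {u<..} x * w u"
      using supp[of u] by (cases "w u = 0") (auto simp: indicator_def)
  qed
  finally have "((\<lambda>u. indicator {u<..} x * w u) has_integral F x - F a) UNIV" .
  moreover have "integrable lborel (\<lambda>u. indicator {u<..} x * w u)"
  proof -
    have "integrable lborel (\<lambda>u. indicator {..<x} u *\<^sub>R w u)"
      using w by (intro integrable_mult_indicator) auto
    then show ?thesis by (simp add: indicator_def)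
  qed
  then have "((\<lambda>u. indicator {u<..} x * w u) has_integral
      (LINT u|lborel. indicator {u<..} x * w u)) UNIV"
    by (rule has_integral_integral_lborel)
  ultimately show ?thesis by (rule has_integral_unique)
qed

text \<open>For almost every $v$ the increment $f_s(x,v) - f_s(a,v)$ is the integral $\Phi(v)$ of the mixed
  derivative in $u$ up to $x$. Fubini's theorem makes $\Phi$ integrable, so the increment of
  $v \mapsto f(x,v) - f(a,v)$, whose derivative agrees with $\Phi$ almost everywhere, is an
  integral of $\Phi$. Subtracting the section at $a$ before integrating is essential, because
  $f_s(x,\cdot)$ alone may fail to be Lebesgue integrable.\<close>

lemma rectangle_increment_eq_integral_of_mixed_derivative:
  fixes f f\<^sub>s f\<^sub>t\<^sub>s h :: "real \<times> real \<Rightarrow> real"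
  assumes partial_s: "\<And>x y. x \<in> {a..b} \<Longrightarrow> y \<in> {c..d} \<Longrightarrow>
      ((\<lambda>v. f (x, v)) has_real_derivative f\<^sub>s (x, y)) (at y within {c..d})"
    and partial_ts: "\<And>x y. x \<in> {a..b} \<Longrightarrow> y \<in> {c..d} \<Longrightarrow>
      ((\<lambda>u. f\<^sub>s (u, y)) has_real_derivative f\<^sub>t\<^sub>s (x, y)) (at x within {a..b})"
    and h: "integrable lborel h"
    and supp: "\<And>z. h z \<noteq> 0 \<Longrightarrow> fst z \<in> {a<..<b} \<and> snd z \<in> {c<..<d}"
    and ae: "AE v in lborel. AE u in lborel. u \<in> {a<..<b} \<longrightarrow> v \<in> {c<..<d} \<longrightarrow> f\<^sub>t\<^sub>s (u, v) = h (u, v)"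
    and x: "x \<in> {a..b}" and y: "y \<in> {c..d}"
  shows "(f (x, y) - f (a, y)) - (f (x, c) - f (a, c))
    = (LINT z|lborel. indicator {snd z<..} y * (indicator {fst z<..} x * h z))"
proof -
  have h2: "integrable (lborel \<Otimes>\<^sub>M lborel) h" using h by (simp add: lborel_prod)
  have hm [measurable]: "h \<in> borel_measurable (lborel \<Otimes>\<^sub>M lborel)" using h2 by auto
  have step [measurable]:
    "(\<lambda>z. indicator {fst z<..} x :: real) \<in> borel_measurable (lborel \<Otimes>\<^sub>M lborel)" for x :: real
    unfolding indicator_def greaterThan_iff by measurable
  have step' [measurable]:
    "(\<lambda>z. indicator {snd z<..} x :: real) \<in> borel_measurable (lborel \<Otimes>\<^sub>M lborel)" for x :: real
    unfolding indicator_def greaterThan_iff by measurable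
  have hx: "integrable (lborel \<Otimes>\<^sub>M lborel) (\<lambda>z. indicator {fst z<..} x * h z)"
    by (rule Bochner_Integration.integrable_bound[OF h2])
      (auto simp: indicator_def intro!: always_eventually)
  have hxy: "integrable (lborel \<Otimes>\<^sub>M lborel) (\<lambda>z. indicator {snd z<..} y * (indicator {fst z<..} x * h z))"
    by (rule Bochner_Integration.integrable_bound[OF h2])
      (auto simp: indicator_def intro!: always_eventually)
  define \<Phi> where "\<Phi> v = (LINT u|lborel. indicator {u<..} x * h (u, v))" for v
  have \<Phi>_int: "integrable lborel \<Phi>"
    unfolding \<Phi>_def
    using lborel_pair.integrable_snd[of "\<lambda>u v. indicator {u<..} x * h (u, v)"] hx
    by (simp add: case_prod_unfold)
  have \<Phi>_supp: "v \<in> {c<..<d}" if "\<Phi> v \<noteq> 0" for v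
  proof (rule ccontr)
    assume "v \<notin> {c<..<d}"
    then have "h (u, v) = 0" for u using supp[of "(u, v)"] by auto
    then show False using that by (simp add: \<Phi>_def)
  qed
  have "AE v in lborel. integrable lborel (\<lambda>u. h (u, v))"
    using lborel_pair.AE_integrable_snd[of "\<lambda>u v. h (u, v)"] h2 by simp
  then have \<Phi>_eq: "AE v in lborel. v \<in> {c<..<d} \<longrightarrow> f\<^sub>s (x, v) - f\<^sub>s (a, v) = \<Phi> v"
    using ae
  proof eventually_elim
    case (elim v)
    show ?case
    proof
      assume v: "v \<in> {c<..<d}"
      show "f\<^sub>s (x, v) - f\<^sub>s (a, v) = \<Phi> v"
        unfolding \<Phi>_def
      proof (rule increment_eq_lebesgue_integral_of_derivative)
        show "((\<lambda>u. f\<^sub>s (u, v)) has_real_derivative f\<^sub>t\<^sub>s (x, v)) (at x within {a..b})"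
          if "x \<in> {a..b}" for x
          using that v by (intro partial_ts) auto
        show "u \<in> {a<..<b}" if "h (u, v) \<noteq> 0" for u
          using supp[OF that] by simp
        show "AE u in lborel. u \<in> {a<..<b} \<longrightarrow> f\<^sub>t\<^sub>s (u, v) = h (u, v)"
          using elim(2) by eventually_elim (use v in auto)
      qed (use elim(1) x in auto)
    qed
  qed
  have "(f (x, y) - f (a, y)) - (f (x, c) - f (a, c)) = (LINT v|lborel. indicator {v<..} y * \<Phi> v)"
  proof (rule increment_eq_lebesgue_integral_of_derivative)
    show "((\<lambda>v. f (x, v) - f (a, v)) has_real_derivative f\<^sub>s (x, v) - f\<^sub>s (a, v)) (at v within {c..d})"
      if "v \<in> {c..d}" for v
      using that x by (intro DERIV_diff partial_s) auto
  qed (use \<Phi>_int \<Phi>_supp \<Phi>_eq y in auto)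
  also have "\<dots> = (LINT v|lborel. LINT u|lborel. indicator {v<..} y * (indicator {u<..} x * h (u, v)))"
    by (simp add: \<Phi>_def)
  also have "\<dots> = (LINT z|lborel. indicator {snd z<..} y * (indicator {fst z<..} x * h z))"
    using lborel_pair.integral_snd[of "\<lambda>u v. indicator {v<..} y * (indicator {u<..} x * h (u, v))"] hxy
    by (simp add: case_prod_unfold lborel_prod)
  finally show ?thesis .
qed

section \<open>The two sides of the identity\<close>

text \<open>The nine point evaluations carry the products of the weights $1/6, 4/6, 1/6$. Integrability of
  the inner defect is what makes $x \mapsto \int f(x,y)\,dy$ integrable; separate continuity of $f$
  alone would not provide it.\<close>

lemma simpson_defect_iterated:
  fixes f :: "real \<times> real \<Rightarrow> real"
  assumes "a < b" "c < d"
    and cont_x: "\<And>y. y \<in> {c..d} \<Longrightarrow> continuous_on {a..b} (\<lambda>x. f (x, y))"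
    and cont_y: "\<And>x. x \<in> {a..b} \<Longrightarrow> continuous_on {c..d} (\<lambda>y. f (x, y))"
    and int: "set_integrable lebesgue {a..b} (\<lambda>x. simpson_defect c d (\<lambda>y. f (x, y)))"
  shows "simpson_defect a b (\<lambda>x. simpson_defect c d (\<lambda>y. f (x, y))) =
    (f (a, (c + d) / 2) + f (b, (c + d) / 2) + 4 * f ((a + b) / 2, (c + d) / 2)
        + f ((a + b) / 2, c) + f ((a + b) / 2, d)) / 9
      + (f (a, c) + f (b, c) + f (a, d) + f (b, d)) / 36
      - 1 / (6 * (b - a)) *
          (LINT x:{a..b}|lebesgue. f (x, c) + 4 * f (x, (c + d) / 2) + f (x, d))
      - 1 / (6 * (d - c)) *
          (LINT y:{c..d}|lebesgue. f (a, y) + 4 * f ((a + b) / 2, y) + f (b, y))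
      + 1 / ((b - a) * (d - c)) *
          (LINT x:{a..b}|lebesgue. (LINT y:{c..d}|lebesgue. f (x, y)))"
proof -
  let ?S = "\<lambda>x. f (x, c) + 4 * f (x, (c + d) / 2) + f (x, d)"
  let ?J = "\<lambda>x. LINT y:{c..d}|lebesgue. f (x, y)"
  have S: "set_integrable lebesgue {a..b} ?S"
    using \<open>c < d\<close> by (intro absolutely_integrable_continuous_real continuous_intros cont_x) auto
  have J_eq: "?J x = (d - c) * (?S x / 6 - simpson_defect c d (\<lambda>y. f (x, y)))" for x
    using \<open>c < d\<close> by (simp add: simpson_defect_def)
  have "set_integrable lebesgue {a..b} (\<lambda>x. (d - c) * (?S x / 6 - simpson_defect c d (\<lambda>y. f (x, y))))"
    using S int by (intro set_integrable_mult_right set_integral_diff(1) set_integrable_divide) auto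
  then have J: "set_integrable lebesgue {a..b} ?J"
    by (simp only: J_eq[symmetric])
  have D_int: "(LINT x:{a..b}|lebesgue. simpson_defect c d (\<lambda>y. f (x, y)))
      = (LINT x:{a..b}|lebesgue. ?S x) / 6 - (LINT x:{a..b}|lebesgue. ?J x) / (d - c)"
    unfolding simpson_defect_def using S J
    by (subst set_integral_diff(2)) (auto intro: set_integrable_divide)
  have fy: "set_integrable lebesgue {c..d} (\<lambda>y. f (x, y))" if "x \<in> {a..b}" for x
    using that by (intro absolutely_integrable_continuous_real cont_y)
  have J_sum: "(LINT y:{c..d}|lebesgue. f (a, y) + 4 * f ((a + b) / 2, y) + f (b, y))
      = ?J a + 4 * ?J ((a + b) / 2) + ?J b"
    using \<open>a < b\<close> fy by simp
  have regroup: "((p / 6 - j / l) + 4 * (q / 6 - j' / l) + (r / 6 - j'' / l)) / 6 - (i / 6 - i' / l) / k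
      = (p + 4 * q + r) / 36 - 1 / (6 * k) * i - 1 / (6 * l) * (j + 4 * j' + j'') + 1 / (k * l) * i'"
    for p q r i i' j j' j'' k l :: real
    by (simp add: add_divide_distrib diff_divide_distrib algebra_simps)
  have "simpson_defect a b (\<lambda>x. simpson_defect c d (\<lambda>y. f (x, y)))
      = (?S a + 4 * ?S ((a + b) / 2) + ?S b) / 36
        - 1 / (6 * (b - a)) * (LINT x:{a..b}|lebesgue. ?S x)
        - 1 / (6 * (d - c)) * (?J a + 4 * ?J ((a + b) / 2) + ?J b)
        + 1 / ((b - a) * (d - c)) * (LINT x:{a..b}|lebesgue. ?J x)"
    unfolding simpson_defect_def[of a b] D_int
    by (simp only: simpson_defect_def[of c d] regroup)
  then show ?thesis
    unfolding J_sum by (simp add: add_divide_distrib)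
qed

text \<open>After the affine substitution the inner integrand is the kernel times a section of $g$. For almost
  every $v$ this section agrees almost everywhere with that of $h$, and only then does Fubini's
  theorem apply.\<close>

lemma kernel_integral_eq_representative:
  fixes g h :: "real \<times> real \<Rightarrow> real"
  assumes "a < b" "c < d"
    and h: "integrable lborel h"
    and supp: "\<And>z. h z \<noteq> 0 \<Longrightarrow> fst z \<in> {a<..<b} \<and> snd z \<in> {c<..<d}"
    and ae: "AE v in lborel. AE u in lborel. u \<in> {a<..<b} \<longrightarrow> v \<in> {c<..<d} \<longrightarrow> g (u, v) = h (u, v)"
  shows "(b - a) * (d - c) *
          (LINT s:{0..1}|lebesgue. (LINT t:{0..1}|lebesgue.
             simpson_kernel t * simpson_kernel s * g (t * a + (1 - t) * b, s * c + (1 - s) * d)))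
    = (LINT z|lborel. simpson_kernel ((b - fst z) / (b - a)) *
        (simpson_kernel ((d - snd z) / (d - c)) * h z))"
proof -
  define \<kappa> where "\<kappa> u = simpson_kernel ((b - u) / (b - a))" for u
  define \<mu> where "\<mu> v = simpson_kernel ((d - v) / (d - c))" for v
  have \<kappa>: "simpson_kernel t = \<kappa> (t * a + (1 - t) * b)" for t
  proof -
    have "b - (t * a + (1 - t) * b) = t * (b - a)" by (simp add: algebra_simps)
    with \<open>a < b\<close> show ?thesis by (simp add: \<kappa>_def)
  qed
  have \<mu>: "simpson_kernel t = \<mu> (t * c + (1 - t) * d)" for t
  proof -
    have "d - (t * c + (1 - t) * d) = t * (d - c)" by (simp add: algebra_simps)
    with \<open>c < d\<close> show ?thesis by (simp add: \<mu>_def)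
  qed
  have [measurable]: "\<kappa> \<in> borel_measurable borel" "\<mu> \<in> borel_measurable borel"
    unfolding \<kappa>_def[abs_def] \<mu>_def[abs_def] by measurable
  have h2: "integrable (lborel \<Otimes>\<^sub>M lborel) h" using h by (simp add: lborel_prod)
  have hm [measurable]: "h \<in> borel_measurable (lborel \<Otimes>\<^sub>M lborel)" using h2 by auto
  let ?W = "\<lambda>z. \<kappa> (fst z) * (\<mu> (snd z) * h z)"
  have W: "integrable (lborel \<Otimes>\<^sub>M lborel) ?W"
  proof (rule Bochner_Integration.integrable_bound[OF h2])
    show "AE z in lborel \<Otimes>\<^sub>M lborel. norm (?W z) \<le> norm (h z)"
    proof (intro always_eventually allI)
      fix z :: "real \<times> real"
      show "norm (?W z) \<le> norm (h z)"
      proof (cases "h z = 0")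
        case False
        then have z: "fst z \<in> {a<..<b}" "snd z \<in> {c<..<d}" using supp by auto
        have "\<bar>\<kappa> (fst z)\<bar> \<le> 1" "\<bar>\<mu> (snd z)\<bar> \<le> 1"
          unfolding \<kappa>_def \<mu>_def using z by (auto intro!: abs_simpson_kernel_le_1)
        then have "\<bar>\<kappa> (fst z)\<bar> * (\<bar>\<mu> (snd z)\<bar> * \<bar>h z\<bar>) \<le> 1 * (1 * \<bar>h z\<bar>)"
          by (intro mult_mono) auto
        then show ?thesis by (simp add: abs_mult)
      qed simp
    qed
  qed measurable
  have Wm: "?W \<in> borel_measurable (lborel \<Otimes>\<^sub>M lborel)" using W by auto
  have inner: "AE v in lborel. indicator {c..d} v *\<^sub>R
      (LINT u:{a..b}|lebesgue. \<kappa> u * \<mu> v * g (u, v)) = (LINT u|lborel. ?W (u, v))"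
    using ae AE_lborel_singleton[of c] AE_lborel_singleton[of d]
  proof eventually_elim
    case (elim v)
    show ?case
    proof (cases "v \<in> {c<..<d}")
      case True
      have "(LINT u:{a..b}|lebesgue. \<kappa> u * \<mu> v * g (u, v)) = (LINT u|lborel. ?W (u, v))"
        unfolding set_lebesgue_integral_def
      proof (rule lebesgue_integral_eq_lborel_representative)
        show "AE u in lborel. indicator {a..b} u *\<^sub>R (\<kappa> u * \<mu> v * g (u, v)) = ?W (u, v)"
          using elim(1) AE_lborel_singleton[of a] AE_lborel_singleton[of b]
        proof eventually_elim
          case (elim u)
          show ?case
          proof (cases "u \<in> {a<..<b}")
            case True
            then show ?thesis using elim(1) \<open>v \<in> {c<..<d}\<close> by simp
          next
            case False
            then have "h (u, v) = 0" using supp[of "(u, v)"] by auto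
            moreover have "u \<notin> {a..b}" using False elim by auto
            ultimately show ?thesis by simp
          qed
        qed
        show "(\<lambda>u. ?W (u, v)) \<in> borel_measurable lborel"
          using measurable_Pair2[OF Wm, of v] by simp
      qed
      then show ?thesis using True by simp
    next
      case False
      then have "h (u, v) = 0" for u using supp[of "(u, v)"] by auto
      moreover have "v \<notin> {c..d}" using False elim by auto
      ultimately show ?thesis by simp
    qed
  qed
  have subst_t: "(LINT t:{0..1}|lebesgue.
         simpson_kernel t * simpson_kernel s * g (t * a + (1 - t) * b, s * c + (1 - s) * d))
      = (LINT u:{a..b}|lebesgue.
         \<kappa> u * \<mu> (s * c + (1 - s) * d) * g (u, s * c + (1 - s) * d)) / (b - a)" for s
    using lebesgue_integral_unit_parametrization[OF \<open>a < b\<close>,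
        of "\<lambda>u. \<kappa> u * \<mu> (s * c + (1 - s) * d) * g (u, s * c + (1 - s) * d)"]
    by (simp only: \<kappa>[symmetric] \<mu>[symmetric])
  have "(LINT s:{0..1}|lebesgue. (LINT t:{0..1}|lebesgue.
         simpson_kernel t * simpson_kernel s * g (t * a + (1 - t) * b, s * c + (1 - s) * d)))
      = (LINT s:{0..1}|lebesgue. (LINT u:{a..b}|lebesgue.
         \<kappa> u * \<mu> (s * c + (1 - s) * d) * g (u, s * c + (1 - s) * d)) / (b - a))"
    by (simp only: subst_t)
  also have "\<dots> = (LINT v:{c..d}|lebesgue. (LINT u:{a..b}|lebesgue. \<kappa> u * \<mu> v * g (u, v)) / (b - a))
      / (d - c)"
    by (rule lebesgue_integral_unit_parametrization[OF \<open>c < d\<close>])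
  also have "\<dots> = (LINT v:{c..d}|lebesgue. (LINT u:{a..b}|lebesgue. \<kappa> u * \<mu> v * g (u, v)))
      / ((b - a) * (d - c))"
    by simp
  also have "(LINT v:{c..d}|lebesgue. (LINT u:{a..b}|lebesgue. \<kappa> u * \<mu> v * g (u, v)))
      = (LINT v|lborel. LINT u|lborel. ?W (u, v))"
    unfolding set_lebesgue_integral_def[of lebesgue "{c..d}"]
    by (rule lebesgue_integral_eq_lborel_representative[OF _ inner]) measurable
  also have "\<dots> = (LINT z|lborel. ?W z)"
    using lborel_pair.integral_snd[of "\<lambda>u v. ?W (u, v)"] W by (simp add: case_prod_unfold lborel_prod)
  finally show ?thesis
    using \<open>a < b\<close> \<open>c < d\<close> by (simp add: \<kappa>_def \<mu>_def)
qed

theorem lemma1: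
  fixes a b c d :: real
    and f f\<^sub>t f\<^sub>s f\<^sub>t\<^sub>s :: "real \<times> real \<Rightarrow> real"
  assumes "a < b" and "c < d"
    and partial_t: "\<And>x y. x \<in> {a..b} \<Longrightarrow> y \<in> {c..d} \<Longrightarrow>
      ((\<lambda>u. f (u, y)) has_real_derivative f\<^sub>t (x, y)) (at x within {a..b})"
    and partial_s: "\<And>x y. x \<in> {a..b} \<Longrightarrow> y \<in> {c..d} \<Longrightarrow>
      ((\<lambda>v. f (x, v)) has_real_derivative f\<^sub>s (x, y)) (at y within {c..d})"
    and partial_ts: "\<And>x y. x \<in> {a..b} \<Longrightarrow> y \<in> {c..d} \<Longrightarrow>
      ((\<lambda>u. f\<^sub>s (u, y)) has_real_derivative f\<^sub>t\<^sub>s (x, y)) (at x within {a..b})"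
    and integrable_ts: "f\<^sub>t\<^sub>s absolutely_integrable_on ({a..b} \<times> {c..d})"
  shows
    "(f (a, (c + d) / 2) + f (b, (c + d) / 2) + 4 * f ((a + b) / 2, (c + d) / 2)
        + f ((a + b) / 2, c) + f ((a + b) / 2, d)) / 9
      + (f (a, c) + f (b, c) + f (a, d) + f (b, d)) / 36
      - 1 / (6 * (b - a)) *
          (LINT x:{a..b}|lebesgue. f (x, c) + 4 * f (x, (c + d) / 2) + f (x, d))
      - 1 / (6 * (d - c)) *
          (LINT y:{c..d}|lebesgue. f (a, y) + 4 * f ((a + b) / 2, y) + f (b, y))
      + 1 / ((b - a) * (d - c)) *
          (LINT x:{a..b}|lebesgue. (LINT y:{c..d}|lebesgue. f (x, y)))
     = (b - a) * (d - c) *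
          (LINT s:{0..1}|lebesgue. (LINT t:{0..1}|lebesgue.
             simpson_kernel t * simpson_kernel s * f\<^sub>t\<^sub>s (t * a + (1 - t) * b, s * c + (1 - s) * d)))"
proof -
  obtain h where h: "integrable lborel h"
    and supp: "\<And>z. h z \<noteq> 0 \<Longrightarrow> fst z \<in> {a<..<b} \<and> snd z \<in> {c<..<d}"
    and ae: "AE v in lborel. AE u in lborel.
      u \<in> {a<..<b} \<longrightarrow> v \<in> {c<..<d} \<longrightarrow> f\<^sub>t\<^sub>s (u, v) = h (u, v)"
    using borel_representative_on_open_rectangle[OF integrable_ts] by blast
  \<comment> \<open>\<open>R\<close> is the part of \<open>f\<close> that depends on both variables.\<close>
  define R where "R x y = (LINT z|lborel. indicator {snd z<..} y * (indicator {fst z<..} x * h z))"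
    for x y
  have f_eq: "f (x, y) = (f (x, c) - f (a, c)) + f (a, y) + R x y"
    if "x \<in> {a..b}" "y \<in> {c..d}" for x y
    using rectangle_increment_eq_integral_of_mixed_derivative[OF partial_s partial_ts h supp ae that]
    by (simp add: R_def)
  have cont_x: "continuous_on {a..b} (\<lambda>x. f (x, y))" if "y \<in> {c..d}" for y
    using partial_t[OF _ that] by (rule DERIV_continuous_on)
  have cont_y: "continuous_on {c..d} (\<lambda>y. f (x, y))" if "x \<in> {a..b}" for x
    using partial_s[OF that] by (rule DERIV_continuous_on)
  have hm [measurable]: "h \<in> borel_measurable borel" using h by auto
  \<comment> \<open>After the defect in the second variable, the remaining superposition of steps in the first
    variable has these weights.\<close>
  define G where "G z = - simpson_kernel ((d - snd z) / (d - c)) * h z" for z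
  have hx: "integrable lborel (\<lambda>z. indicator {fst z<..} x * h z)" for x
  proof (rule Bochner_Integration.integrable_bound[OF h])
    have "(\<lambda>z::real \<times> real. indicator {fst z<..} x :: real) \<in> borel_measurable borel"
      unfolding indicator_def greaterThan_iff borel_prod[symmetric] by measurable
    then show "(\<lambda>z. indicator {fst z<..} x * h z) \<in> borel_measurable lborel"
      by simp
  qed (auto simp: indicator_def intro!: always_eventually)
  have G: "integrable lborel G"
  proof (rule Bochner_Integration.integrable_bound[OF h])
    have "(\<lambda>z::real \<times> real. simpson_kernel ((d - snd z) / (d - c))) \<in> borel_measurable borel"
      unfolding borel_prod[symmetric] by measurable
    then show "G \<in> borel_measurable lborel"
      unfolding G_def[abs_def] by simp
    show "AE z in lborel. norm (G z) \<le> norm (h z)"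
    proof (intro always_eventually allI)
      fix z
      show "norm (G z) \<le> norm (h z)"
      proof (cases "h z = 0")
        case False
        then have "snd z \<in> {c<..<d}" using supp by auto
        then have "\<bar>simpson_kernel ((d - snd z) / (d - c))\<bar> \<le> 1"
          by (intro abs_simpson_kernel_le_1) auto
        then show ?thesis by (simp add: G_def abs_mult mult_left_le_one_le)
      qed (simp add: G_def)
    qed
  qed
  have R_int: "set_integrable lebesgue {c..d} (R x)" for x
    unfolding R_def[abs_def]
    by (rule simpson_defect_superposition_of_steps(1)[OF sigma_finite_lborel \<open>c < d\<close> hx])
      (use supp in \<open>auto simp: borel_prod[symmetric]\<close>)
  have R_defect: "simpson_defect c d (R x) = (LINT z|lborel. indicator {fst z<..} x * G z)" for x
    unfolding R_def[abs_def]
    by (subst simpson_defect_superposition_of_steps(2)[OF sigma_finite_lborel \<open>c < d\<close> hx])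
      (use supp in \<open>auto simp: borel_prod[symmetric] G_def algebra_simps\<close>)
  \<comment> \<open>The section at \<open>a\<close> contributes a constant in \<open>x\<close>, which the defect in the first variable kills.\<close>
  have sect: "simpson_defect c d (\<lambda>y. f (x, y))
      = simpson_defect c d (\<lambda>y. f (a, y)) + (LINT z|lborel. indicator {fst z<..} x * G z)"
    if x: "x \<in> {a..b}" for x
  proof -
    have fa: "set_integrable lebesgue {c..d} (\<lambda>y. f (a, y))"
      using \<open>a < b\<close> by (intro absolutely_integrable_continuous_real cont_y) auto
    have "simpson_defect c d (\<lambda>y. f (x, y))
        = simpson_defect c d (\<lambda>y. ((f (x, c) - f (a, c)) + f (a, y)) + R x y)"
      using f_eq[OF x] by (intro simpson_defect_cong[OF \<open>c < d\<close>])
    also have "\<dots> = simpson_defect c d (\<lambda>_. f (x, c) - f (a, c))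
        + simpson_defect c d (\<lambda>y. f (a, y)) + simpson_defect c d (R x)"
      using fa R_int set_integrable_const_interval
      by (simp add: simpson_defect_add del: set_integral_diff)
    finally show ?thesis
      by (simp add: R_defect simpson_defect_const[OF \<open>c < d\<close>])
  qed
  have sect_ind: "indicator {a..b} x *\<^sub>R simpson_defect c d (\<lambda>y. f (x, y))
      = indicator {a..b} x *\<^sub>R (simpson_defect c d (\<lambda>y. f (a, y))
          + (LINT z|lborel. indicator {fst z<..} x * G z))" for x
    using sect[of x] by (cases "x \<in> {a..b}") auto
  have steps: "set_integrable lebesgue {a..b} (\<lambda>x. LINT z|lborel. indicator {fst z<..} x * G z)"
    "simpson_defect a b (\<lambda>x. LINT z|lborel. indicator {fst z<..} x * G z)
      = - (LINT z|lborel. simpson_kernel ((b - fst z) / (b - a)) * G z)"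
    by (rule simpson_defect_superposition_of_steps[OF sigma_finite_lborel \<open>a < b\<close> G];
        use supp in \<open>force simp: borel_prod[symmetric] G_def\<close>)+
  have "set_integrable lebesgue {a..b} (\<lambda>x. simpson_defect c d (\<lambda>y. f (a, y))
      + (LINT z|lborel. indicator {fst z<..} x * G z))"
    using steps(1) set_integrable_const_interval by (intro set_integral_add(1))
  then have "set_integrable lebesgue {a..b} (\<lambda>x. simpson_defect c d (\<lambda>y. f (x, y)))"
    by (simp only: set_integrable_def sect_ind)
  note expand = simpson_defect_iterated[of a b c d f, OF \<open>a < b\<close> \<open>c < d\<close> cont_x cont_y this]
  have "simpson_defect a b (\<lambda>x. simpson_defect c d (\<lambda>y. f (x, y)))
      = simpson_defect a b (\<lambda>x. simpson_defect c d (\<lambda>y. f (a, y))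
          + (LINT z|lborel. indicator {fst z<..} x * G z))"
    using sect by (intro simpson_defect_cong[OF \<open>a < b\<close>])
  also have "\<dots> = - (LINT z|lborel. simpson_kernel ((b - fst z) / (b - a)) * G z)"
    by (simp add: simpson_defect_add[OF set_integrable_const_interval steps(1)]
        simpson_defect_const[OF \<open>a < b\<close>] steps(2))
  also have "\<dots> = (LINT z|lborel. simpson_kernel ((b - fst z) / (b - a)) *
        (simpson_kernel ((d - snd z) / (d - c)) * h z))"
    by (simp add: G_def)
  also have "\<dots> = (b - a) * (d - c) *
          (LINT s:{0..1}|lebesgue. (LINT t:{0..1}|lebesgue.
             simpson_kernel t * simpson_kernel s * f\<^sub>t\<^sub>s (t * a + (1 - t) * b, s * c + (1 - s) * d)))"
    using kernel_integral_eq_representative[OF \<open>a < b\<close> \<open>c < d\<close> h supp ae] by simp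
  finally show ?thesis
    using expand by simp
qed

end
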